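(* Suppose that $X$ is a separable metrizable space and $K\subseteq\mathbb R^X$ is a compact space (in the product topology) such that for every $g\in K$ and every nonempty closed set $F\subseteq X$, the restricted function $g_{|F}:F\to\mathbb R$ has a point of continuity. Then every measure $\mu\in P(K)$ is of countable type.
   Context: For a compact space $K$, $P(K)$ is the set of Radon probability measures on $K$. A measure $\mu\in P(K)$ is of countable (Maharam) type if $L_1(\mu)$ is separable; equivalently, there is a countable family $\mathcal F$ of Borel subsets of $K$ such that for every Borel set $B\subseteq K$ and every $\varepsilon>0$ there is $F\in\mathcal F$ with $\mu(B\bigtriangleup F)<\varepsilon$. *)

theory Defs
  imports "HOL-Probability.Probability"
begin

definition borel_of :: "'a topology \<Rightarrow> 'a measure" where
  "borel_of T = sigma (topspace T) {U. openin T U}"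

text \<open>
  The set \<open>P(K)\<close> for the space \<open>T\<close>. Compact sets are Borel, and hence \<open>emeasure\<close> does not take its
  default value 0 on them, whenever \<open>T\<close> is Hausdorff.
\<close>
definition radon_probability_measures :: "'a topology \<Rightarrow> 'a measure set" where
  "radon_probability_measures T =
     {\<mu>. prob_space \<mu> \<and> sets \<mu> = sets (borel_of T) \<and>
         (\<forall>B \<in> sets \<mu>. emeasure \<mu> B = (SUP C \<in> {C. compactin T C \<and> C \<subseteq> B}. emeasure \<mu> C))}"

text \<open>
  Separability of \<open>L\<^sub>1(\<mu>)\<close>, expressed with representatives: \<open>L\<^sub>1(\<mu>)\<close> is the space of real
  integrable functions modulo almost-everywhere equality, and the integral of \<open>\<bar>f - d\<bar>\<close> is the
  distance between the classes of \<open>f\<close> and \<open>d\<close>.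
\<close>
definition countable_type :: "'a measure \<Rightarrow> bool" where
  "countable_type \<mu> \<longleftrightarrow>
     (\<exists>D :: ('a \<Rightarrow> real) set. countable D \<and> D \<subseteq> {d. integrable \<mu> d} \<and>
        (\<forall>f :: 'a \<Rightarrow> real. integrable \<mu> f \<longrightarrow>
           (\<forall>\<epsilon>>0. \<exists>d\<in>D. (\<integral>x. \<bar>f x - d x\<bar> \<partial>\<mu>) < \<epsilon>)))"

end

theory Submission
  imports Defs
begin

text \<open>
  Write \<open>e x g = g x\<close> and fix \<open>\<delta> > 0\<close> and a countable base \<open>B n\<close> of \<open>X\<close>. For each \<open>n\<close> let \<open>H n\<close> be the
  essentially largest measurable set on which all \<open>e x\<close>, \<open>x \<in> B n\<close>, are a.e. \<open>\<delta>\<close>-close to functions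
  measurable for one countably generated \<open>\<sigma>\<close>-algebra, and let \<open>R g\<close> be the closed set of all points
  outside every \<open>B n\<close> with \<open>g \<in> H n\<close>. If \<open>R g\<close> is nonempty, a continuity point of the restriction of
  \<open>g\<close> to \<open>R g\<close> gives a \<open>B n\<close> meeting \<open>R g\<close> on which \<open>g\<close> oscillates by at most \<open>\<delta>\<close>. For fixed \<open>n\<close> the set
  \<open>S n\<close> of these \<open>g\<close> need not be measurable, but on its measurable hull \<open>G\<close> the inequality
  \<open>\<bar>e x - e y\<bar> \<le> \<delta>\<close> still holds a.e. where \<open>x\<close> and \<open>y\<close> lie in \<open>R g\<close>. Hence countably many \<open>e y\<close> approximate
  all \<open>e x\<close> on \<open>G\<close>, so \<open>G\<close> is essentially contained in \<open>H n\<close> although \<open>S n\<close> is disjoint from \<open>H n\<close>: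
  thus \<open>S n\<close> is null, and \<open>R g\<close> is empty for almost all \<open>g\<close>. Letting \<open>\<delta>\<close> tend to 0, all evaluations are
  measurable modulo null sets for one countably generated \<open>\<sigma>\<close>-algebra, and by inner regularity so are
  all Borel sets.
\<close>

subsection \<open>Essential suprema and measurable hulls\<close>

text \<open>A countable union of countable subfamilies is again a countable subfamily, so the
  supremum of the measures of countable unions is attained by some \<open>\<D>\<close>. Adjoining
  one more \<open>A\<close> cannot raise this measure, and since it is finite it can be cancelled,
  which leaves measure 0 for the rest of \<open>A\<close>.\<close>

lemma (in finite_measure) essential_Union:
  assumes "\<A> \<subseteq> sets M"
  obtains \<D> where "countable \<D>" "\<D> \<subseteq> \<A>" "\<And>A. A \<in> \<A> \<Longrightarrow> A - \<Union>\<D> \<in> null_sets M"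
proof -
  let ?I = "{\<D>. countable \<D> \<and> \<D> \<subseteq> \<A>}"
  have "?I \<noteq> {}"
    by auto
  from ennreal_SUP_countable_SUP[OF this, of "\<lambda>\<D>. emeasure M (\<Union>\<D>)"]
  obtain f :: "nat \<Rightarrow> ennreal"
    where f: "range f \<subseteq> (\<lambda>\<D>. emeasure M (\<Union>\<D>)) ` ?I"
      and s: "(SUP \<D>\<in>?I. emeasure M (\<Union>\<D>)) = (SUP i. f i)"
    by blast
  from f have "\<forall>i. \<exists>\<D>. \<D> \<in> ?I \<and> f i = emeasure M (\<Union>\<D>)"
    by blast
  then obtain D where D: "\<And>i. D i \<in> ?I" "\<And>i. f i = emeasure M (\<Union>(D i))"
    by metis
  define \<D> where "\<D> = (\<Union>i. D i)"
  have \<D>: "countable \<D>" "\<D> \<subseteq> \<A>"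
    using D unfolding \<D>_def by auto
  have meas: "\<Union>\<D> \<in> sets M"
    using \<D> assms by (intro sets.countable_Union) auto
  have "(SUP i. f i) \<le> emeasure M (\<Union>\<D>)"
    unfolding D(2) by (intro SUP_least emeasure_mono meas) (auto simp: \<D>_def)
  with s have le: "emeasure M (\<Union>\<E>) \<le> emeasure M (\<Union>\<D>)" if "\<E> \<in> ?I" for \<E>
    by (metis (no_types, lifting) SUP_upper order_trans that)
  have "A - \<Union>\<D> \<in> null_sets M" if A: "A \<in> \<A>" for A
  proof -
    have AM: "A \<in> sets M"
      using A assms by auto
    have "emeasure M (\<Union>\<D> \<union> A) \<le> emeasure M (\<Union>\<D>)"
      using le[of "insert A \<D>"] A \<D> by (auto simp: Un_commute)
    moreover have "emeasure M (\<Union>\<D> \<union> A) = emeasure M (\<Union>\<D>) + emeasure M (A - \<Union>\<D>)"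
      using plus_emeasure[of "\<Union>\<D>" M "A - \<Union>\<D>"] AM meas by auto
    ultimately have "emeasure M (A - \<Union>\<D>) = 0"
      by (metis add.right_neutral add_left_mono antisym_conv emeasure_finite
          ennreal_add_left_cancel infinity_ennreal_def zero_le)
    then show ?thesis
      using AM meas by auto
  qed
  with \<D> show ?thesis
    by (intro that) auto
qed

text \<open>\<open>S\<close> may be nonmeasurable. The hull is the complement of the essential union
  of all measurable sets disjoint from \<open>S\<close>: the complement of any measurable
  \<open>A\<close> containing \<open>S\<close> is one of these sets.\<close>

lemma (in finite_measure) measurable_hull:
  assumes "S \<subseteq> space M"
  obtains H where "H \<in> sets M" "S \<subseteq> H"
    "\<And>A. A \<in> sets M \<Longrightarrow> S \<subseteq> A \<Longrightarrow> AE \<omega> in M. \<omega> \<in> H \<longrightarrow> \<omega> \<in> A"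
proof -
  define \<A> where "\<A> = {A \<in> sets M. S \<inter> A = {}}"
  have "\<A> \<subseteq> sets M"
    by (auto simp: \<A>_def)
  then obtain \<D> where \<D>: "countable \<D>" "\<D> \<subseteq> \<A>" "\<And>A. A \<in> \<A> \<Longrightarrow> A - \<Union>\<D> \<in> null_sets M"
    by (rule essential_Union) blast
  show ?thesis
  proof
    have "\<Union>\<D> \<in> sets M"
      using \<D>(1,2) by (intro sets.countable_Union) (auto simp: \<A>_def)
    then show "space M - \<Union>\<D> \<in> sets M"
      by auto
    show "S \<subseteq> space M - \<Union>\<D>"
      using assms \<D>(2) by (auto simp: \<A>_def)
    show "AE \<omega> in M. \<omega> \<in> space M - \<Union>\<D> \<longrightarrow> \<omega> \<in> A" if "A \<in> sets M" "S \<subseteq> A" for A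
    proof (rule AE_I')
      show "(space M - A) - \<Union>\<D> \<in> null_sets M"
        using that by (intro \<D>(3)) (auto simp: \<A>_def)
    qed auto
  qed
qed

subsection \<open>Approximation by a countably generated \<open>\<sigma>\<close>-algebra\<close>

definition approximates ::
    "'m measure \<Rightarrow> real \<Rightarrow> ('m \<Rightarrow> real) set \<Rightarrow> 'm set \<Rightarrow> 'm set set \<Rightarrow> bool" where
  "approximates M \<delta> E H C \<longleftrightarrow>
     (\<forall>h\<in>E. \<exists>f\<in>borel_measurable (sigma (space M) C).
        AE \<omega> in M. \<omega> \<in> H \<longrightarrow> \<bar>f \<omega> - h \<omega>\<bar> \<le> \<delta>)"

text \<open>One countable \<open>C\<close> has to serve the whole, possibly uncountable, family
  \<open>E\<close>, while the approximant and its exceptional null set may vary with the member of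
  \<open>E\<close>.\<close>

definition sigma_approximable ::
    "'m measure \<Rightarrow> real \<Rightarrow> ('m \<Rightarrow> real) set \<Rightarrow> 'm set \<Rightarrow> bool" where
  "sigma_approximable M \<delta> E H \<longleftrightarrow>
     (\<exists>C. countable C \<and> C \<subseteq> sets M \<and> approximates M \<delta> E H C)"

lemma approximatesE:
  assumes "approximates M \<delta> E H C" "h \<in> E"
  obtains f where "f \<in> borel_measurable (sigma (space M) C)"
    "AE \<omega> in M. \<omega> \<in> H \<longrightarrow> \<bar>f \<omega> - h \<omega>\<bar> \<le> \<delta>"
  using assms unfolding approximates_def by blast

lemma sets_sigma_mono:
  assumes "C \<subseteq> C'" "C' \<subseteq> sets M"
  shows "sets (sigma (space M) C) \<subseteq> sets (sigma (space M) C')"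
proof -
  have "C' \<subseteq> Pow (space M)" "C \<subseteq> Pow (space M)"
    using assms sets.space_closed[of M] by blast+
  then show ?thesis
    using assms(1) by (simp add: sigma_sets_mono')
qed

lemma borel_measurable_sigma_mono:
  assumes "f \<in> borel_measurable (sigma (space M) C)" "C \<subseteq> C'" "C' \<subseteq> sets M"
  shows "f \<in> borel_measurable (sigma (space M) C')"
proof -
  have "space (sigma (space M) C) = space (sigma (space M) C')"
    by (simp add: space_measure_of_conv)
  with assms(1) sets_sigma_mono[OF assms(2,3)] show ?thesis
    unfolding measurable_def by (simp add: subset_iff)
qed

lemma in_sets_sigma:
  assumes "A \<in> C" "C \<subseteq> sets M"
  shows "A \<in> sets (sigma (space M) C)"
proof -
  have "C \<subseteq> Pow (space M)"
    using assms(2) sets.space_closed[of M] by (rule subset_trans)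
  with assms(1) show ?thesis
    by simp
qed

text \<open>Rational thresholds suffice because a sublevel set at \<open>a\<close> is the
  intersection of those at rationals above \<open>a\<close>. Thus countably many new generators make
  a function measurable.\<close>

lemma borel_measurable_rat_le:
  fixes f :: "'m \<Rightarrow> real"
  assumes "\<And>q. q \<in> \<rat> \<Longrightarrow> {\<omega> \<in> space N. f \<omega> \<le> q} \<in> sets N"
  shows "f \<in> borel_measurable N"
proof (rule borel_measurableI_le)
  fix a :: real
  let ?Q = "{q \<in> \<rat>. a < q}"
  have Q: "countable ?Q" "?Q \<noteq> {}"
    using Rats_dense_in_real[of a "a + 1"] countable_subset[OF _ countable_rat, of ?Q] by auto
  have le: "f \<omega> \<le> a" if "\<And>q. q \<in> \<rat> \<Longrightarrow> a < q \<Longrightarrow> f \<omega> \<le> q" for \<omega>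
  proof (rule ccontr)
    assume "\<not> f \<omega> \<le> a"
    then obtain q where "q \<in> \<rat>" "a < q" "q < f \<omega>"
      using Rats_dense_in_real[of a "f \<omega>"] by auto
    with that[of q] show False
      by simp
  qed
  have "{\<omega> \<in> space N. f \<omega> \<le> a} = (\<Inter>q\<in>?Q. {\<omega> \<in> space N. f \<omega> \<le> q})"
  proof (intro set_eqI iffI)
    fix \<omega> assume \<omega>: "\<omega> \<in> (\<Inter>q\<in>?Q. {\<omega> \<in> space N. f \<omega> \<le> q})"
    then have "\<omega> \<in> space N"
      using Q(2) by blast
    moreover have "f \<omega> \<le> a"
      using \<omega> by (intro le) auto
    ultimately show "\<omega> \<in> {\<omega> \<in> space N. f \<omega> \<le> a}"
      by simp
  qed auto
  also have "\<dots> \<in> sets N"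
    using assms Q by (intro sets.countable_INT') auto
  finally show "{\<omega> \<in> space N. f \<omega> \<le> a} \<in> sets N" .
qed

text \<open>The approximant at a point is the one belonging to the first \<open>A j\<close> that
  contains it. The pieces must lie in \<open>N\<close>, but \<open>H\<close> need not.\<close>

lemma glue_approximations:
  fixes A :: "nat \<Rightarrow> 'm set" and f :: "nat \<Rightarrow> 'm \<Rightarrow> real"
  assumes [measurable]: "\<And>j. A j \<in> sets N" "\<And>j. f j \<in> borel_measurable N"
    and approx: "\<And>j. AE \<omega> in M. \<omega> \<in> A j \<inter> H \<longrightarrow> \<bar>f j \<omega> - h \<omega>\<bar> \<le> \<delta>"
    and cover: "AE \<omega> in M. \<omega> \<in> H \<longrightarrow> \<omega> \<in> (\<Union>j. A j)"
  shows "\<exists>g\<in>borel_measurable N. AE \<omega> in M. \<omega> \<in> H \<longrightarrow> \<bar>g \<omega> - h \<omega>\<bar> \<le> \<delta>"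
proof
  \<comment> \<open>Outside all \<open>A j\<close> the \<open>LEAST\<close> is some unspecified but
    fixed index, so measurability survives; by \<open>cover\<close> that region meets
    \<open>H\<close> only in a null set.\<close>
  let ?g = "\<lambda>\<omega>. f (LEAST j. \<omega> \<in> A j) \<omega>"
  show "?g \<in> borel_measurable N"
    by (rule measurable_compose_countable) measurable
  have "AE \<omega> in M. \<forall>j. \<omega> \<in> A j \<inter> H \<longrightarrow> \<bar>f j \<omega> - h \<omega>\<bar> \<le> \<delta>"
    using approx by (simp add: AE_all_countable)
  with cover show "AE \<omega> in M. \<omega> \<in> H \<longrightarrow> \<bar>?g \<omega> - h \<omega>\<bar> \<le> \<delta>"
  proof eventually_elim
    case (elim \<omega>)
    then show ?case
      by (metis IntI LeastI UN_E)
  qed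
qed

text \<open>Besides the given generators, the sets \<open>H j\<close> themselves become generators,
  so that gluing along them stays measurable.\<close>

lemma sigma_approximable_UN:
  fixes H :: "nat \<Rightarrow> 'm set"
  assumes H: "\<And>j. H j \<in> sets M" and approx: "\<And>j. sigma_approximable M \<delta> E (H j)"
  shows "sigma_approximable M \<delta> E (\<Union>j. H j)"
proof -
  obtain C where C: "\<And>j. countable (C j)" "\<And>j. C j \<subseteq> sets M"
    "\<And>j. approximates M \<delta> E (H j) (C j)"
    using approx unfolding sigma_approximable_def by metis
  define C' where "C' = (\<Union>j. C j) \<union> range H"
  have C': "countable C'" "C' \<subseteq> sets M" "\<And>j. C j \<subseteq> C'" "\<And>j. H j \<in> C'"
    using C(1,2) H by (auto simp: C'_def)
  have "\<exists>g\<in>borel_measurable (sigma (space M) C').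
          AE \<omega> in M. \<omega> \<in> (\<Union>j. H j) \<longrightarrow> \<bar>g \<omega> - h \<omega>\<bar> \<le> \<delta>" if h: "h \<in> E" for h
  proof -
    obtain f where f: "\<And>j. f j \<in> borel_measurable (sigma (space M) (C j))"
      "\<And>j. AE \<omega> in M. \<omega> \<in> H j \<longrightarrow> \<bar>f j \<omega> - h \<omega>\<bar> \<le> \<delta>"
    proof -
      have "\<forall>j. \<exists>f. f \<in> borel_measurable (sigma (space M) (C j)) \<and>
          (AE \<omega> in M. \<omega> \<in> H j \<longrightarrow> \<bar>f \<omega> - h \<omega>\<bar> \<le> \<delta>)"
        using C(3) h unfolding approximates_def Bex_def by simp
      from choice[OF this] show ?thesis
        using that by auto
    qed
    show ?thesis
    proof (rule glue_approximations[where A = H and f = f])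
      show "H j \<in> sets (sigma (space M) C')" for j
        using C' by (intro in_sets_sigma)
      show "f j \<in> borel_measurable (sigma (space M) C')" for j
        by (rule borel_measurable_sigma_mono[OF f(1) C'(3,2)])
      show "AE \<omega> in M. \<omega> \<in> H j \<inter> (\<Union>j. H j) \<longrightarrow> \<bar>f j \<omega> - h \<omega>\<bar> \<le> \<delta>" for j
        using f(2)[of j] by eventually_elim auto
    qed auto
  qed
  with C'(1,2) show ?thesis
    unfolding sigma_approximable_def approximates_def by (intro exI conjI ballI)
qed

text \<open>The essential union of all approximable sets is a countable union of such sets, hence is
  itself approximable.\<close>

lemma (in finite_measure) maximal_sigma_approximable:
  obtains H where "H \<in> sets M" "sigma_approximable M \<delta> E H"
    "\<And>A. A \<in> sets M \<Longrightarrow> sigma_approximable M \<delta> E A \<Longrightarrow> A - H \<in> null_sets M"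
proof -
  define \<A> where "\<A> = {A \<in> sets M. sigma_approximable M \<delta> E A}"
  have "{} \<in> \<A>"
    unfolding \<A>_def sigma_approximable_def approximates_def
    by (auto intro!: exI[of _ "{}"] exI[of _ "\<lambda>_. 0"] simp: Bex_def)
  have "\<A> \<subseteq> sets M"
    by (auto simp: \<A>_def)
  then obtain \<D> where \<D>: "countable \<D>" "\<D> \<subseteq> \<A>" "\<And>A. A \<in> \<A> \<Longrightarrow> A - \<Union>\<D> \<in> null_sets M"
    by (rule essential_Union) blast
  \<comment> \<open>The empty set is inserted only to have a nonempty family to enumerate; it is
    approximable and does not change the union.\<close>
  define D where "D = from_nat_into (insert {} \<D>)"
  have D: "range D = insert {} \<D>"
    unfolding D_def using \<D>(1) by (intro range_from_nat_into) auto
  have "D j \<in> insert {} \<D>" for j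
    using D by blast
  moreover have "insert {} \<D> \<subseteq> \<A>"
    using \<D>(2) \<open>{} \<in> \<A>\<close> by simp
  ultimately have "D j \<in> \<A>" for j
    by (rule rev_subsetD)
  then have D': "D j \<in> sets M" "sigma_approximable M \<delta> E (D j)" for j
    by (auto simp: \<A>_def)
  have eq: "(\<Union>j. D j) = \<Union>\<D>"
    using D by auto
  show ?thesis
  proof
    show "(\<Union>j. D j) \<in> sets M"
      using D' by auto
    show "sigma_approximable M \<delta> E (\<Union>j. D j)"
      using D' by (rule sigma_approximable_UN)
    show "A - (\<Union>j. D j) \<in> null_sets M" if "A \<in> sets M" "sigma_approximable M \<delta> E A" for A
      unfolding eq using that by (intro \<D>(3)) (auto simp: \<A>_def)
  qed
qed

text \<open>This is the exhaustion argument freed from topology: \<open>B\<close> plays the base and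
  \<open>frag\<close> the point of continuity. \<open>frag\<close> ranges over all \<open>J\<close>
  because it is applied to \<open>{n. \<omega> \<in> H n}\<close>, which varies with
  \<open>\<omega>\<close>.\<close>

lemma (in finite_measure) sigma_approximable_if_fragmented:
  fixes X :: "'x set" and B :: "nat \<Rightarrow> 'x set" and e :: "'x \<Rightarrow> 'a \<Rightarrow> real"
  assumes e[measurable]: "\<And>x. x \<in> X \<Longrightarrow> e x \<in> borel_measurable M"
    and BX: "\<And>n. B n \<subseteq> X"
    and frag: "\<And>\<omega> J. \<omega> \<in> space M \<Longrightarrow> X - (\<Union>n\<in>J. B n) \<noteq> {} \<Longrightarrow>
       \<exists>n. B n - (\<Union>n\<in>J. B n) \<noteq> {} \<and>
         (\<forall>x \<in> B n - (\<Union>n\<in>J. B n). \<forall>y \<in> B n - (\<Union>n\<in>J. B n). \<bar>e x \<omega> - e y \<omega>\<bar> \<le> \<delta>)"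
  shows "sigma_approximable M \<delta> (e ` X) (space M)"
proof -
  have "\<forall>n. \<exists>H. H \<in> sets M \<and> sigma_approximable M \<delta> (e ` B n) H \<and>
      (\<forall>A. A \<in> sets M \<longrightarrow> sigma_approximable M \<delta> (e ` B n) A \<longrightarrow> A - H \<in> null_sets M)"
    by (metis maximal_sigma_approximable)
  then obtain H where H: "\<And>n. H n \<in> sets M" "\<And>n. sigma_approximable M \<delta> (e ` B n) (H n)"
    "\<And>n A. A \<in> sets M \<Longrightarrow> sigma_approximable M \<delta> (e ` B n) A \<Longrightarrow> A - H n \<in> null_sets M"
    by metis
  note [measurable] = H(1)
  \<comment> \<open>\<open>F x\<close> and \<open>R \<omega>\<close> (below) are the two families of sections of one subset of the product of \<open>X\<close> and the
    measure space.\<close>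
  define F where "F x = space M - (\<Union>m\<in>{m. x \<in> B m}. H m)" for x
  have F_sets[measurable]: "F x \<in> sets M" for x
    unfolding F_def by measurable
  obtain C0 where C0: "\<And>n. countable (C0 n)" "\<And>n. C0 n \<subseteq> sets M"
    "\<And>n. approximates M \<delta> (e ` B n) (H n) (C0 n)"
    using H(2) unfolding sigma_approximable_def by metis
  \<comment> \<open>The sets \<open>H n\<close> are included so that every \<open>F x\<close>, the
    complement of a countable union of them, belongs to the generated \<sigma>-algebra.\<close>
  define C where "C = (\<Union>n. C0 n) \<union> range H"
  have C: "countable C" "C \<subseteq> sets M" "\<And>j. C0 j \<subseteq> C" "\<And>j. H j \<in> C"
    using C0(1,2) H(1) by (auto simp: C_def)
  have F_sigma: "F x \<in> sets (sigma (space M) C')" if "C \<subseteq> C'" "C' \<subseteq> sets M" for C' x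
  proof -
    have "H m \<in> sets (sigma (space M) C')" for m
      using that C(4) by (intro in_sets_sigma) auto
    moreover have "space M \<in> sets (sigma (space M) C')"
      using sets.top[of "sigma (space M) C'"] by (simp add: space_measure_of_conv)
    ultimately show ?thesis
      unfolding F_def by (intro sets.Diff sets.countable_UN') auto
  qed
  \<comment> \<open>A point outside \<open>F x\<close> lies in some \<open>H n\<close> with
    \<open>x \<in> B n\<close>, where an approximation of \<open>e x\<close> is already available;
    these countably many approximations are glued.\<close>
  have off_F: "\<exists>f\<in>borel_measurable (sigma (space M) C).
      AE \<omega> in M. \<omega> \<in> space M - F x \<longrightarrow> \<bar>f \<omega> - e x \<omega>\<bar> \<le> \<delta>" for x
  proof -
    have "\<forall>n. \<exists>f. f \<in> borel_measurable (sigma (space M) C) \<and>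
        (x \<in> B n \<longrightarrow> (AE \<omega> in M. \<omega> \<in> H n \<longrightarrow> \<bar>f \<omega> - e x \<omega>\<bar> \<le> \<delta>))"
    proof
      fix n
      show "\<exists>f. f \<in> borel_measurable (sigma (space M) C) \<and>
          (x \<in> B n \<longrightarrow> (AE \<omega> in M. \<omega> \<in> H n \<longrightarrow> \<bar>f \<omega> - e x \<omega>\<bar> \<le> \<delta>))"
      proof (cases "x \<in> B n")
        case True
        then obtain f where "f \<in> borel_measurable (sigma (space M) (C0 n))"
          "AE \<omega> in M. \<omega> \<in> H n \<longrightarrow> \<bar>f \<omega> - e x \<omega>\<bar> \<le> \<delta>"
          using approximatesE[OF C0(3) imageI] by blast
        then show ?thesis
          using borel_measurable_sigma_mono[OF _ C(3,2)] by blast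
      next
        case False
        then show ?thesis
          by (intro exI[of _ "\<lambda>_. 0"]) auto
      qed
    qed
    from choice[OF this] obtain f where f: "\<And>n. f n \<in> borel_measurable (sigma (space M) C)"
      "\<And>n. x \<in> B n \<Longrightarrow> AE \<omega> in M. \<omega> \<in> H n \<longrightarrow> \<bar>f n \<omega> - e x \<omega>\<bar> \<le> \<delta>"
      by auto
    show ?thesis
    proof (rule glue_approximations[where A = "\<lambda>n. if x \<in> B n then H n else {}" and f = f])
      show "(if x \<in> B n then H n else {}) \<in> sets (sigma (space M) C)" for n
        using C by (auto intro: in_sets_sigma)
      show "AE \<omega> in M. \<omega> \<in> (if x \<in> B n then H n else {}) \<inter> (space M - F x) \<longrightarrow>
          \<bar>f n \<omega> - e x \<omega>\<bar> \<le> \<delta>" for n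
      proof (cases "x \<in> B n")
        case True
        from f(2)[OF this] show ?thesis
          by eventually_elim auto
      qed simp
      show "AE \<omega> in M. \<omega> \<in> space M - F x \<longrightarrow> \<omega> \<in> (\<Union>n. if x \<in> B n then H n else {})"
        by (rule AE_I2) (auto simp: F_def)
    qed (rule f(1))
  qed
  define R where "R \<omega> = X - (\<Union>n\<in>{n. \<omega> \<in> H n}. B n)" for \<omega>
  have R_F: "x \<in> R \<omega> \<longleftrightarrow> \<omega> \<in> F x" if "\<omega> \<in> space M" "x \<in> X" for x \<omega>
    using that by (auto simp: R_def F_def)
  define S where "S n = {\<omega> \<in> space M. B n \<inter> R \<omega> \<noteq> {} \<and>
      (\<forall>x\<in>B n \<inter> R \<omega>. \<forall>y\<in>B n \<inter> R \<omega>. \<bar>e x \<omega> - e y \<omega>\<bar> \<le> \<delta>)}" for n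
  have S_null: "\<exists>N\<in>null_sets M. S n \<subseteq> N" for n
  proof -
    have "S n \<subseteq> space M"
      by (auto simp: S_def)
    then obtain G where G: "G \<in> sets M" "S n \<subseteq> G"
      "\<And>A. A \<in> sets M \<Longrightarrow> S n \<subseteq> A \<Longrightarrow> AE \<omega> in M. \<omega> \<in> G \<longrightarrow> \<omega> \<in> A"
      by (rule measurable_hull) blast
    \<comment> \<open>\<open>S n\<close> involves uncountably many conditions, but for one fixed
      pair the condition defines a measurable set containing \<open>S n\<close>, so it passes to the
      hull \<open>G\<close>. The exceptional null set depends on the pair.\<close>
    have close: "AE \<omega> in M. \<omega> \<in> G \<inter> F x \<inter> F y \<longrightarrow> \<bar>e y \<omega> - e x \<omega>\<bar> \<le> \<delta>"
      if xy: "x \<in> B n" "y \<in> B n" for x y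
    proof -
      have [measurable]: "e x \<in> borel_measurable M" "e y \<in> borel_measurable M"
        using xy BX[of n] by auto
      let ?A = "{\<omega> \<in> space M. \<omega> \<in> F x \<and> \<omega> \<in> F y \<longrightarrow> \<bar>e y \<omega> - e x \<omega>\<bar> \<le> \<delta>}"
      have "?A \<in> sets M"
        by measurable
      moreover have "S n \<subseteq> ?A"
      proof
        fix \<omega> assume \<omega>: "\<omega> \<in> S n"
        then have "\<omega> \<in> space M"
          by (simp add: S_def)
        moreover have "\<bar>e y \<omega> - e x \<omega>\<bar> \<le> \<delta>" if "\<omega> \<in> F x" "\<omega> \<in> F y"
        proof -
          have "x \<in> B n \<inter> R \<omega>" "y \<in> B n \<inter> R \<omega>"
            using that xy BX[of n] R_F \<open>\<omega> \<in> space M\<close> by auto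
          with \<omega> show ?thesis
            by (simp add: S_def)
        qed
        ultimately show "\<omega> \<in> ?A"
          by simp
      qed
      ultimately have "AE \<omega> in M. \<omega> \<in> G \<longrightarrow> \<omega> \<in> ?A"
        by (rule G(3))
      then show ?thesis
        by eventually_elim auto
    qed
    have "F ` B n \<subseteq> sets M"
      by auto
    \<comment> \<open>This yields a countable \<open>Y\<close> inside \<open>B n\<close> such that
      each \<open>F x\<close> with \<open>x \<in> B n\<close> is covered, up to a null set, by the
      sets \<open>F y\<close> with \<open>y \<in> Y\<close>.\<close>
    then obtain \<D> where \<D>: "countable \<D>" "\<D> \<subseteq> F ` B n"
      "\<And>A. A \<in> F ` B n \<Longrightarrow> A - \<Union>\<D> \<in> null_sets M"
      by (rule essential_Union) blast
    obtain Y where Y: "countable Y" "Y \<subseteq> B n" "\<D> = F ` Y"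
      using \<D>(1,2) countable_subset_image[of \<D> F "B n"] by auto
    \<comment> \<open>The rational sublevel sets make each \<open>e y\<close> with
      \<open>y \<in> Y\<close> measurable while the family of generators stays countable.\<close>
    define C' where "C' = insert G C \<union> (\<Union>y\<in>Y. \<Union>q\<in>\<rat>. {{\<omega>\<in>space M. e y \<omega> \<le> q}})"
    have C': "countable C'" "C' \<subseteq> sets M" "C \<subseteq> C'"
    proof -
      show "countable C'"
        unfolding C'_def using C(1) Y(1)
        by (intro countable_Un countable_insert countable_UN countable_rat) auto
      have "e y \<in> borel_measurable M" if "y \<in> Y" for y
        using that Y(2) BX[of n] by auto
      then show "C' \<subseteq> sets M"
        unfolding C'_def using G(1) C(2) by (auto simp: borel_measurable_iff_le)
    qed (auto simp: C'_def)
    have e_C': "e y \<in> borel_measurable (sigma (space M) C')" if "y \<in> Y" for y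
    proof (rule borel_measurable_rat_le)
      fix q :: real assume "q \<in> \<rat>"
      then have "{\<omega> \<in> space M. e y \<omega> \<le> q} \<in> sets (sigma (space M) C')"
        using that C'(2) by (intro in_sets_sigma) (auto simp: C'_def)
      then show "{\<omega> \<in> space (sigma (space M) C'). e y \<omega> \<le> q} \<in> sets (sigma (space M) C')"
        by (simp add: space_measure_of_conv)
    qed
    have "sigma_approximable M \<delta> (e ` B n) G"
      unfolding sigma_approximable_def approximates_def
    proof (intro exI conjI ballI)
      fix h assume "h \<in> e ` B n"
      then obtain x where x: "x \<in> B n" "h = e x"
        by auto
      obtain f1 where f1: "f1 \<in> borel_measurable (sigma (space M) C)"
        "AE \<omega> in M. \<omega> \<in> space M - F x \<longrightarrow> \<bar>f1 \<omega> - e x \<omega>\<bar> \<le> \<delta>"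
        using off_F by blast
      \<comment> \<open>Where \<open>\<omega>\<close> lies in \<open>G\<close>, \<open>F x\<close>
        and \<open>F y\<close>, the function \<open>e y\<close> is itself a \<delta>-approximation
        of \<open>e x\<close> by \<open>close\<close>. Gluing over an enumeration of
        \<open>Y\<close> covers almost all of \<open>G \<inter> F x\<close>.\<close>
      have "\<exists>f2\<in>borel_measurable (sigma (space M) C').
          AE \<omega> in M. \<omega> \<in> G \<inter> F x \<longrightarrow> \<bar>f2 \<omega> - e x \<omega>\<bar> \<le> \<delta>"
      \<comment> \<open>With \<open>Y\<close> empty there is nothing to enumerate, but then
        \<open>F x\<close> is null and any function will do.\<close>
      proof (cases "Y = {}")
        case True
        have "F x - \<Union>\<D> \<in> null_sets M"
          using \<D>(3) x by auto
        then have "AE \<omega> in M. \<omega> \<notin> F x"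
          using True Y(3) by (auto intro!: AE_not_in)
        then show ?thesis
          by (intro bexI[of _ "\<lambda>_. 0"]) auto
      next
        case False
        define y where "y = from_nat_into Y"
        have y: "range y = Y"
          unfolding y_def using False Y(1) by (rule range_from_nat_into)
        then have yY: "y j \<in> Y" for j
          by auto
        show ?thesis
        proof (rule glue_approximations[where A = "\<lambda>j. F (y j)" and f = "\<lambda>j. e (y j)"])
          show "F (y j) \<in> sets (sigma (space M) C')" for j
            using C' by (intro F_sigma)
          show "e (y j) \<in> borel_measurable (sigma (space M) C')" for j
            by (intro e_C' yY)
          show "AE \<omega> in M. \<omega> \<in> F (y j) \<inter> (G \<inter> F x) \<longrightarrow> \<bar>e (y j) \<omega> - e x \<omega>\<bar> \<le> \<delta>" for j
          proof -
            have "y j \<in> B n"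
              using yY Y(2) by auto
            from close[OF x(1) this] show ?thesis
              by eventually_elim auto
          qed
          have "F x - \<Union>\<D> \<in> null_sets M"
            using \<D>(3) x by auto
          then have "AE \<omega> in M. \<omega> \<notin> F x - \<Union>\<D>"
            by (rule AE_not_in)
          moreover have "\<Union>\<D> = (\<Union>j. F (y j))"
            using Y(3) y by auto
          ultimately show "AE \<omega> in M. \<omega> \<in> G \<inter> F x \<longrightarrow> \<omega> \<in> (\<Union>j. F (y j))"
            by auto
        qed
      qed
      then obtain f2 where f2: "f2 \<in> borel_measurable (sigma (space M) C')"
        "AE \<omega> in M. \<omega> \<in> G \<inter> F x \<longrightarrow> \<bar>f2 \<omega> - e x \<omega>\<bar> \<le> \<delta>"
        by blast
      show "\<exists>f\<in>borel_measurable (sigma (space M) C').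
          AE \<omega> in M. \<omega> \<in> G \<longrightarrow> \<bar>f \<omega> - h \<omega>\<bar> \<le> \<delta>"
      proof
        have [measurable]: "F x \<in> sets (sigma (space M) C')"
          using C' by (intro F_sigma)
        have [measurable]: "f1 \<in> borel_measurable (sigma (space M) C')"
          by (rule borel_measurable_sigma_mono[OF f1(1) C'(3,2)])
        note [measurable] = f2(1)
        show "(\<lambda>\<omega>. if \<omega> \<in> F x then f2 \<omega> else f1 \<omega>) \<in> borel_measurable (sigma (space M) C')"
          by measurable
        show "AE \<omega> in M. \<omega> \<in> G \<longrightarrow> \<bar>(if \<omega> \<in> F x then f2 \<omega> else f1 \<omega>) - h \<omega>\<bar> \<le> \<delta>"
          using f1(2) f2(2) AE_space by eventually_elim (auto simp: x(2))
      qed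
    qed (use C' in auto)
    \<comment> \<open>Maximality of \<open>H n\<close> enters here.\<close>
    then have "G - H n \<in> null_sets M"
      using G(1) by (intro H(3))
    \<comment> \<open>If \<open>\<omega> \<in> H n\<close>, then \<open>R \<omega>\<close> omits all
      of \<open>B n\<close>, whereas membership in \<open>S n\<close> demands that they
      meet.\<close>
    moreover have "S n \<inter> H n = {}"
      by (auto simp: S_def R_def)
    ultimately show ?thesis
      using G(2) by (intro bexI[of _ "G - H n"]) auto
  qed
  have cover: "\<omega> \<in> (\<Union>n. S n)" if "\<omega> \<in> space M" "R \<omega> \<noteq> {}" for \<omega>
  proof -
    have "B n \<inter> R \<omega> = B n - (\<Union>n\<in>{n. \<omega> \<in> H n}. B n)" for n
      using BX[of n] by (auto simp: R_def)
    then show ?thesis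
      using frag[OF that(1), of "{n. \<omega> \<in> H n}"] that by (auto simp: S_def R_def[symmetric])
  qed
  obtain N where N: "\<And>n. N n \<in> null_sets M" "\<And>n. S n \<subseteq> N n"
    using S_null by metis
  \<comment> \<open>A point of \<open>F x\<close> has \<open>x \<in> R \<omega>\<close>, so by
    \<open>cover\<close> it lies in one of the countably many null sets \<open>N n\<close>.\<close>
  have F_null: "AE \<omega> in M. \<omega> \<notin> F x" if "x \<in> X" for x
  proof (rule AE_I')
    show "(\<Union>n. N n) \<in> null_sets M"
      using N(1) by auto
    show "{\<omega> \<in> space M. \<not> \<omega> \<notin> F x} \<subseteq> (\<Union>n. N n)"
    proof
      fix \<omega> assume "\<omega> \<in> {\<omega> \<in> space M. \<not> \<omega> \<notin> F x}"
      then have "\<omega> \<in> space M" "R \<omega> \<noteq> {}"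
        using R_F[of \<omega> x] that by auto
      then show "\<omega> \<in> (\<Union>n. N n)"
        using cover N(2) by blast
    qed
  qed
  have "\<exists>f\<in>borel_measurable (sigma (space M) C).
      AE \<omega> in M. \<omega> \<in> space M \<longrightarrow> \<bar>f \<omega> - e x \<omega>\<bar> \<le> \<delta>" if "x \<in> X" for x
  proof -
    obtain f where "f \<in> borel_measurable (sigma (space M) C)"
        "AE \<omega> in M. \<omega> \<in> space M - F x \<longrightarrow> \<bar>f \<omega> - e x \<omega>\<bar> \<le> \<delta>"
      using off_F by blast
    with F_null[OF that] show ?thesis
      by (intro bexI[of _ f]) auto
  qed
  with C(1,2) show ?thesis
    unfolding sigma_approximable_def approximates_def by (intro exI conjI ballI) auto
qed

subsection \<open>Separability of \<open>L\<^sub>1\<close>\<close>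

text \<open>The integral defaults to 0 when the integrand is not integrable, so a nonintegrable
  \<open>d\<close> could count as being at distance 0. The lemmas on closures therefore assume that
  \<open>D\<close> consists of integrable functions.\<close>

definition L1_closure :: "'m measure \<Rightarrow> ('m \<Rightarrow> real) set \<Rightarrow> ('m \<Rightarrow> real) set" where
  "L1_closure M D =
     {f. integrable M f \<and> (\<forall>\<epsilon>>0. \<exists>d\<in>D. (\<integral>x. \<bar>f x - d x\<bar> \<partial>M) < \<epsilon>)}"

lemma L1_triangle:
  fixes f g h :: "'m \<Rightarrow> real"
  assumes "integrable M f" "integrable M g" "integrable M h"
  shows "(\<integral>x. \<bar>f x - h x\<bar> \<partial>M) \<le> (\<integral>x. \<bar>f x - g x\<bar> \<partial>M) + (\<integral>x. \<bar>g x - h x\<bar> \<partial>M)"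
proof -
  have "(\<integral>x. \<bar>f x - h x\<bar> \<partial>M) \<le> (\<integral>x. \<bar>f x - g x\<bar> + \<bar>g x - h x\<bar> \<partial>M)"
    using assms by (intro integral_mono) auto
  also have "\<dots> = (\<integral>x. \<bar>f x - g x\<bar> \<partial>M) + (\<integral>x. \<bar>g x - h x\<bar> \<partial>M)"
    using assms by (intro Bochner_Integration.integral_add) auto
  finally show ?thesis .
qed

lemma L1_closure_closed:
  assumes D: "D \<subseteq> {d. integrable M d}" and f: "integrable M f"
    and lim: "\<And>\<epsilon>. \<epsilon> > 0 \<Longrightarrow> \<exists>g\<in>L1_closure M D. (\<integral>x. \<bar>f x - g x\<bar> \<partial>M) < \<epsilon>"
  shows "f \<in> L1_closure M D"
  unfolding L1_closure_def
proof (intro CollectI conjI f allI impI)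
  fix \<epsilon> :: real assume "\<epsilon> > 0"
  then obtain g where g: "g \<in> L1_closure M D" "(\<integral>x. \<bar>f x - g x\<bar> \<partial>M) < \<epsilon> / 2"
    using lim[of "\<epsilon> / 2"] by auto
  then obtain d where d: "d \<in> D" "(\<integral>x. \<bar>g x - d x\<bar> \<partial>M) < \<epsilon> / 2"
    using \<open>\<epsilon> > 0\<close> unfolding L1_closure_def by (auto dest!: spec[of _ "\<epsilon> / 2"])
  have "(\<integral>x. \<bar>f x - d x\<bar> \<partial>M) \<le> (\<integral>x. \<bar>f x - g x\<bar> \<partial>M) + (\<integral>x. \<bar>g x - d x\<bar> \<partial>M)"
    using f g(1) d(1) D by (intro L1_triangle) (auto simp: L1_closure_def)
  with g(2) d show "\<exists>d\<in>D. (\<integral>x. \<bar>f x - d x\<bar> \<partial>M) < \<epsilon>"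
    by (intro bexI[of _ d]) auto
qed

lemma L1_closure_add:
  assumes D: "D \<subseteq> {d. integrable M d}"
    and D_add: "\<And>d d'. d \<in> D \<Longrightarrow> d' \<in> D \<Longrightarrow> (\<lambda>x. d x + d' x) \<in> D"
    and f: "f \<in> L1_closure M D" and g: "g \<in> L1_closure M D"
  shows "(\<lambda>x. f x + g x) \<in> L1_closure M D"
  unfolding L1_closure_def
proof (intro CollectI conjI allI impI)
  have fg: "integrable M f" "integrable M g"
    using f g by (auto simp: L1_closure_def)
  then show "integrable M (\<lambda>x. f x + g x)"
    by auto
  fix \<epsilon> :: real assume "\<epsilon> > 0"
  then obtain d d' where d: "d \<in> D" "(\<integral>x. \<bar>f x - d x\<bar> \<partial>M) < \<epsilon> / 2"
      and d': "d' \<in> D" "(\<integral>x. \<bar>g x - d' x\<bar> \<partial>M) < \<epsilon> / 2"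
    using f g unfolding L1_closure_def by (auto dest!: spec[of _ "\<epsilon> / 2"])
  have int: "integrable M d" "integrable M d'"
    using D d d' by auto
  have "(\<integral>x. \<bar>(f x + g x) - (d x + d' x)\<bar> \<partial>M) \<le> (\<integral>x. \<bar>f x - d x\<bar> + \<bar>g x - d' x\<bar> \<partial>M)"
    using fg int by (intro integral_mono) auto
  also have "\<dots> = (\<integral>x. \<bar>f x - d x\<bar> \<partial>M) + (\<integral>x. \<bar>g x - d' x\<bar> \<partial>M)"
    using fg int by (intro Bochner_Integration.integral_add) auto
  finally show "\<exists>d\<in>D. (\<integral>x. \<bar>f x + g x - d x\<bar> \<partial>M) < \<epsilon>"
    using d d' by (intro bexI[OF _ D_add[OF d(1) d'(1)]]) auto
qed

lemma L1_closure_cong_AE: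
  assumes "f \<in> L1_closure M D" "D \<subseteq> {d. integrable M d}"
    and "g \<in> borel_measurable M" "AE x in M. f x = g x"
  shows "g \<in> L1_closure M D"
proof (rule L1_closure_closed[OF assms(2)])
  have f: "integrable M f"
    using assms(1) by (auto simp: L1_closure_def)
  then show "integrable M g"
    using assms(3,4) by (auto intro: integrable_cong_AE_imp)
  show "\<exists>h\<in>L1_closure M D. (\<integral>x. \<bar>g x - h x\<bar> \<partial>M) < \<epsilon>" if "\<epsilon> > 0" for \<epsilon>
  proof
    have "AE x in M. \<bar>g x - f x\<bar> = 0"
      using assms(4) by eventually_elim auto
    then have "(\<integral>x. \<bar>g x - f x\<bar> \<partial>M) = 0"
      by (rule integral_eq_zero_AE)
    with that show "(\<integral>x. \<bar>g x - f x\<bar> \<partial>M) < \<epsilon>"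
      by simp
  qed (rule assms(1))
qed

lemma L1_closure_dominated_convergence:
  assumes D: "D \<subseteq> {d. integrable M d}"
    and s: "\<And>i. s i \<in> L1_closure M D" and f: "integrable M f" and w: "integrable M w"
    and lim: "\<And>x. x \<in> space M \<Longrightarrow> (\<lambda>i::nat. s i x) \<longlonglongrightarrow> f x"
    and bound: "\<And>i x. x \<in> space M \<Longrightarrow> \<bar>s i x\<bar> \<le> w x"
  shows "f \<in> L1_closure M D"
proof (rule L1_closure_closed[OF D f])
  have [measurable]: "s i \<in> borel_measurable M" for i
    using s by (auto simp: L1_closure_def)
  have [measurable]: "f \<in> borel_measurable M"
    using f by auto
  have "(\<lambda>i. \<integral>x. \<bar>f x - s i x\<bar> \<partial>M) \<longlonglongrightarrow> (\<integral>x. 0 \<partial>M)"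
  proof (rule integral_dominated_convergence)
    show "integrable M (\<lambda>x. \<bar>f x\<bar> + w x)"
      using f w by auto
    show "AE x in M. (\<lambda>i. \<bar>f x - s i x\<bar>) \<longlonglongrightarrow> 0"
    proof (rule AE_I2)
      fix x assume "x \<in> space M"
      from tendsto_rabs[OF tendsto_diff[OF tendsto_const[of "f x"] lim[OF this]]]
      show "(\<lambda>i. \<bar>f x - s i x\<bar>) \<longlonglongrightarrow> 0"
        by simp
    qed
    show "AE x in M. norm \<bar>f x - s i x\<bar> \<le> \<bar>f x\<bar> + w x" for i
    proof (rule AE_I2)
      fix x assume "x \<in> space M"
      from bound[OF this, of i] show "norm \<bar>f x - s i x\<bar> \<le> \<bar>f x\<bar> + w x"
        by simp
    qed
  qed measurable
  then have conv: "(\<lambda>i. \<integral>x. \<bar>f x - s i x\<bar> \<partial>M) \<longlonglongrightarrow> 0"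
    by simp
  show "\<exists>g\<in>L1_closure M D. (\<integral>x. \<bar>f x - g x\<bar> \<partial>M) < \<epsilon>" if "\<epsilon> > 0" for \<epsilon>
    using order_tendstoD(2)[OF conv that] s by (auto simp: eventually_sequentially)
qed

text \<open>Rational combinations of indicators of finite intersections from \<open>C\<close> are
  dense. Dynkin's \<pi>-\<lambda> argument reaches the indicators of the generated \<sigma>-algebra,
  \<open>mod_null\<close> reaches those of all measurable sets, and induction over integrable
  functions does the rest.\<close>

lemma (in finite_measure) countable_type_if_countably_generated_mod_null:
  assumes C: "countable C" "C \<subseteq> sets M"
    and mod_null: "\<And>A. A \<in> sets M \<Longrightarrow>
      \<exists>B\<in>sigma_sets (space M) C. AE x in M. x \<in> A \<longleftrightarrow> x \<in> B"
  shows "countable_type M"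
proof -
  have indicator_int: "integrable M (\<lambda>x. c * indicator A x)" if "A \<in> sets M" for A and c :: real
    using that by (intro integrable_mult_right integrable_real_indicator) (auto simp: less_top[symmetric])
  \<comment> \<open>This is the \<pi>-system generated by \<open>C\<close>. Intersecting with
    \<open>space M\<close> makes the empty \<open>F\<close> contribute the whole space instead of
    \<open>UNIV\<close>.\<close>
  define G where "G = (\<lambda>F. space M \<inter> \<Inter>F) ` {F. F \<subseteq> C \<and> finite F}"
  have "countable {F. F \<subseteq> C \<and> finite F}"
    using countable_Collect_finite_subset[OF C(1)] by (simp add: conj_commute)
  then have G_countable: "countable G"
    unfolding G_def by (rule countable_image)
  have G_sets: "G \<subseteq> sets M"
  proof
    fix A assume "A \<in> G"
    then obtain F where F: "F \<subseteq> C" "finite F" "A = space M \<inter> \<Inter>F"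
      by (auto simp: G_def)
    have "{x \<in> space M. \<forall>B\<in>F. x \<in> B} \<in> sets M"
    proof (rule sets.sets_Collect_finite_All[OF _ F(2)])
      fix B assume "B \<in> F"
      then have "B \<in> sets M"
        using F(1) C(2) by auto
      moreover from this have "{x \<in> space M. x \<in> B} = B"
        using sets.sets_into_space by auto
      ultimately show "{x \<in> space M. x \<in> B} \<in> sets M"
        by simp
    qed
    also have "{x \<in> space M. \<forall>B\<in>F. x \<in> B} = A"
      using F(3) by auto
    finally show "A \<in> sets M" .
  qed
  have "Int_stable G"
  proof (rule Int_stableI)
    fix A B assume "A \<in> G" "B \<in> G"
    then obtain F F' where "F \<subseteq> C" "finite F" "A = space M \<inter> \<Inter>F"
        "F' \<subseteq> C" "finite F'" "B = space M \<inter> \<Inter>F'"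
      by (auto simp: G_def)
    then show "A \<inter> B \<in> G"
      unfolding G_def by (intro image_eqI[of _ _ "F \<union> F'"]) auto
  qed
  have "A \<in> G" if "A \<in> C" for A
    unfolding G_def using that C(2) sets.sets_into_space[of A M]
    by (intro image_eqI[of _ _ "{A}"]) auto
  then have "C \<subseteq> G"
    by blast
  have space_G: "space M \<in> G"
    unfolding G_def by (intro image_eqI[of _ _ "{}"]) auto

  \<comment> \<open>Lists keep the set of combinations visibly countable and turn addition into
    concatenation.\<close>
  define comb where "comb l x = (\<Sum>(q, A)\<leftarrow>l. q * indicator A x)" for l :: "(real \<times> 'a set) list" and x
  define D where "D = comb ` lists (\<rat> \<times> G)"
  have D_countable: "countable D"
    unfolding D_def using G_countable countable_rat by (intro countable_image countable_lists) auto
  have "integrable M (comb l)" if "l \<in> lists (\<rat> \<times> G)" for l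
    using that
  proof (induction l)
    case Nil
    then show ?case
      by (simp add: comb_def[abs_def])
  next
    case (Cons p l)
    obtain q A where p: "p = (q, A)" "A \<in> G"
      using Cons by (cases p) auto
    then have "A \<in> sets M"
      using G_sets by auto
    then have "integrable M (\<lambda>x. q * indicator A x)"
      by (rule indicator_int)
    moreover have "comb (p # l) = (\<lambda>x. q * indicator A x + comb l x)"
      by (auto simp: comb_def p)
    ultimately show ?case
      using Cons by auto
  qed
  then have D: "D \<subseteq> {d. integrable M d}"
    by (auto simp: D_def)
  have D_add: "(\<lambda>x. d x + d' x) \<in> D" if "d \<in> D" "d' \<in> D" for d d'
  proof -
    from that obtain l l' where l: "l \<in> lists (\<rat> \<times> G)" "l' \<in> lists (\<rat> \<times> G)" "d = comb l" "d' = comb l'"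
      by (auto simp: D_def)
    then have "(\<lambda>x. d x + d' x) = comb (l @ l')"
      by (auto simp: comb_def)
    with l show ?thesis
      unfolding D_def by (intro image_eqI[of _ _ "l @ l'"]) auto
  qed
  have add_closure: "(\<lambda>x. f x + g x) \<in> L1_closure M D"
    if "f \<in> L1_closure M D" "g \<in> L1_closure M D" for f g
    using D D_add that by (rule L1_closure_add)
  have sigma_G_sets: "sigma_sets (space M) G \<subseteq> sets M"
    using G_sets by (rule sets.sigma_sets_subset)
  have zero: "(\<lambda>x. 0) \<in> L1_closure M D"
  proof -
    have "(\<lambda>x. 0) \<in> D"
      unfolding D_def by (intro image_eqI[of _ _ "[]"]) (auto simp: comb_def)
    then show ?thesis
      unfolding L1_closure_def by (auto intro!: bexI[of _ "\<lambda>x. 0"])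
  qed
  have indicator_G: "(\<lambda>x. c * indicator A x) \<in> L1_closure M D" if "A \<in> G" for A and c :: real
    unfolding L1_closure_def
  proof (intro CollectI conjI allI impI)
    have A: "A \<in> sets M"
      using that G_sets by auto
    then show "integrable M (\<lambda>x. c * indicator A x)"
      by (rule indicator_int)
    fix \<epsilon> :: real assume "\<epsilon> > 0"
    \<comment> \<open>Adding 1 keeps the divisor positive when \<open>A\<close> is null and makes it
      strictly larger than the measure of \<open>A\<close>.\<close>
    define m where "m = measure M A + 1"
    have "m > 0"
      by (simp add: m_def add_nonneg_pos)
    obtain q where q: "q \<in> \<rat>" "c < q" "q < c + \<epsilon> / m"
      using Rats_dense_in_real[of c "c + \<epsilon> / m"] \<open>\<epsilon> > 0\<close> \<open>m > 0\<close> by auto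
    have "(\<integral>x. \<bar>c * indicator A x - q * indicator A x\<bar> \<partial>M) = (\<integral>x. (q - c) * indicator A x \<partial>M)"
      using q(2) by (intro Bochner_Integration.integral_cong) (auto simp: indicator_def)
    also have "\<dots> = (q - c) * measure M A"
      using A by (simp add: sets.Int_space_eq2)
    also have "\<dots> < (\<epsilon> / m) * m"
      using q \<open>m > 0\<close> by (intro mult_strict_mono) (auto simp: m_def)
    finally have "(\<integral>x. \<bar>c * indicator A x - q * indicator A x\<bar> \<partial>M) < \<epsilon>"
      using \<open>m > 0\<close> by simp
    moreover have "(\<lambda>x. q * indicator A x) \<in> D"
      unfolding D_def using q(1) that by (intro image_eqI[of _ _ "[(q, A)]"]) (auto simp: comb_def)
    ultimately show "\<exists>d\<in>D. (\<integral>x. \<bar>c * indicator A x - d x\<bar> \<partial>M) < \<epsilon>"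
      by (intro bexI[of _ "\<lambda>x. q * indicator A x"])
  qed
  \<comment> \<open>All coefficients are treated at once because the complement step applies the
    induction hypothesis with \<open>- c\<close>.\<close>
  have "\<forall>c::real. (\<lambda>x. c * indicator A x) \<in> L1_closure M D" if "A \<in> sigma_sets (space M) G" for A
    using \<open>Int_stable G\<close> subset_trans[OF G_sets sets.space_closed] that
  proof (induction rule: sigma_sets_induct_disjoint)
    case (basic A)
    then show ?case
      using indicator_G by blast
  next
    case empty
    show ?case
      using zero by simp
  next
    case (compl A)
    show ?case
    proof
      fix c :: real
      have [measurable]: "A \<in> sets M"
        using compl sigma_G_sets by auto
      have "(\<lambda>x. c * indicator (space M) x + (- c) * indicator A x) \<in> L1_closure M D"
      proof (rule add_closure)
        show "(\<lambda>x. c * indicator (space M) x) \<in> L1_closure M D"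
          by (rule indicator_G[OF space_G])
        show "(\<lambda>x. (- c) * indicator A x) \<in> L1_closure M D"
          using compl(2) by blast
      qed
      then show "(\<lambda>x. c * indicator (space M - A) x) \<in> L1_closure M D"
        by (rule L1_closure_cong_AE[OF _ D]) (auto simp: indicator_def)
    qed
  next
    case (union A)
    show ?case
    proof
      fix c :: real
      have A[measurable]: "A i \<in> sets M" for i
        using union(2) sigma_G_sets by auto
      \<comment> \<open>By disjointness the partial sums are bounded by
        \<open>\<bar>c\<bar>\<close>, a constant that is integrable since the measure is
        finite.\<close>
      let ?s = "\<lambda>n x. \<Sum>i<n. c * indicator (A i) x"
      have sums: "(\<lambda>i. indicator (A i) x :: real) sums indicator (\<Union>i. A i) x" for x
        using union(1) by (intro indicator_sums) (auto simp: disjoint_family_on_def)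
      show "(\<lambda>x. c * indicator (\<Union>i. A i) x) \<in> L1_closure M D"
      proof (rule L1_closure_dominated_convergence[OF D, where s = ?s and w = "\<lambda>_. \<bar>c\<bar>"])
        show "?s n \<in> L1_closure M D" for n
        proof (induction n)
          case 0
          show ?case
            using zero by simp
        next
          case (Suc n)
          have "(\<lambda>x. c * indicator (A n) x) \<in> L1_closure M D"
            using union(3) by (rule spec)
          from add_closure[OF Suc this] show ?case
            by simp
        qed
        show "integrable M (\<lambda>x. c * indicator (\<Union>i. A i) x)"
          by (intro indicator_int) auto
        show "(\<lambda>n. ?s n x) \<longlonglongrightarrow> c * indicator (\<Union>i. A i) x" for x
          using sums_mult[OF sums, of c x] by (simp add: sums_def)
        show "\<bar>?s n x\<bar> \<le> \<bar>c\<bar>" for n x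
        proof -
          have "(\<Sum>i<n. indicator (A i) x :: real) \<le> indicator (\<Union>i. A i) x"
            using sum_le_suminf[OF sums_summable[OF sums], of "{..<n}" x] sums_unique[OF sums, of x]
            by simp
          also have "\<dots> \<le> 1"
            by (simp add: indicator_def)
          finally have "(\<Sum>i<n. indicator (A i) x :: real) \<le> 1" .
          moreover have "0 \<le> (\<Sum>i<n. indicator (A i) x :: real)"
            by (intro sum_nonneg) auto
          ultimately have "\<bar>c\<bar> * \<bar>\<Sum>i<n. indicator (A i) x\<bar> \<le> \<bar>c\<bar> * 1"
            by (intro mult_left_mono) auto
          then show ?thesis
            by (simp add: sum_distrib_left[symmetric] abs_mult)
        qed
      qed auto
    qed
  qed
  note sigma_G = this
  have "f \<in> L1_closure M D" if "integrable M f" for f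
    using that
  proof (induction rule: integrable_induct)
    case (base A c)
    from mod_null[OF base(1)] obtain B where B: "B \<in> sigma_sets (space M) C"
        "AE x in M. x \<in> A \<longleftrightarrow> x \<in> B"
      by blast
    have "B \<in> sigma_sets (space M) G"
      using B(1) sigma_sets_subseteq[OF \<open>C \<subseteq> G\<close>] by blast
    then have "(\<lambda>x. c * indicator B x) \<in> L1_closure M D"
      using sigma_G by blast
    then show ?case
    proof (rule L1_closure_cong_AE[OF _ D])
      show "(\<lambda>x. indicator A x *\<^sub>R c) \<in> borel_measurable M"
        using base(1) by measurable
      show "AE x in M. c * indicator B x = indicator A x *\<^sub>R c"
        using B(2) by eventually_elim (auto simp: indicator_def)
    qed
  next
    case (add f g)
    show ?case
      using add(3,4) by (rule add_closure)
  next
    case (lim f s)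
    show ?case
    proof (rule L1_closure_dominated_convergence[OF D, where s = s and w = "\<lambda>x. 2 * \<bar>f x\<bar>"])
      show "\<bar>s i x\<bar> \<le> 2 * \<bar>f x\<bar>" if "x \<in> space M" for i x
        using lim(3)[OF that, of i] by simp
    qed (use lim in auto)
  qed
  then show ?thesis
    unfolding countable_type_def using D_countable D by (intro exI[of _ D]) (auto simp: L1_closure_def)
qed

section \<open>Letting the approximation error tend to 0\<close>

lemma (in finite_measure) countably_generated_if_sigma_approximable:
  assumes meas: "\<And>h. h \<in> E \<Longrightarrow> h \<in> borel_measurable M"
    and approx: "\<And>\<delta>. \<delta> > 0 \<Longrightarrow> sigma_approximable M \<delta> E (space M)"
  obtains C where "countable C" "C \<subseteq> sets M"
    "\<And>h. h \<in> E \<Longrightarrow> \<exists>f\<in>borel_measurable (sigma (space M) C). AE \<omega> in M. h \<omega> = f \<omega>"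
proof -
  \<comment> \<open>Errors \<open>1 / Suc k\<close> need only countably many countable families,
    whose union serves all of them.\<close>
  have "\<forall>k::nat. \<exists>C. countable C \<and> C \<subseteq> sets M \<and> approximates M (1 / Suc k) E (space M) C"
    using approx unfolding sigma_approximable_def by simp
  from choice[OF this] obtain C0 where C0: "\<And>k. countable (C0 k)" "\<And>k. C0 k \<subseteq> sets M"
      "\<And>k::nat. approximates M (1 / Suc k) E (space M) (C0 k)"
    by auto
  define C where "C = (\<Union>k. C0 k)"
  have C: "countable C" "C \<subseteq> sets M" "\<And>k. C0 k \<subseteq> C"
    using C0(1,2) by (auto simp: C_def)
  show ?thesis
  proof (rule that[OF C(1,2)])
    fix h assume h: "h \<in> E"
    have "\<forall>k::nat. \<exists>f. f \<in> borel_measurable (sigma (space M) C) \<and>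
        (AE \<omega> in M. \<omega> \<in> space M \<longrightarrow> \<bar>f \<omega> - h \<omega>\<bar> \<le> 1 / Suc k)"
    proof
      fix k :: nat
      obtain f where "f \<in> borel_measurable (sigma (space M) (C0 k))"
          "AE \<omega> in M. \<omega> \<in> space M \<longrightarrow> \<bar>f \<omega> - h \<omega>\<bar> \<le> 1 / Suc k"
        using approximatesE[OF C0(3) h] by blast
      then show "\<exists>f. f \<in> borel_measurable (sigma (space M) C) \<and>
          (AE \<omega> in M. \<omega> \<in> space M \<longrightarrow> \<bar>f \<omega> - h \<omega>\<bar> \<le> 1 / Suc k)"
        using borel_measurable_sigma_mono[OF _ C(3,2)] by blast
    qed
    from choice[OF this] obtain f :: "nat \<Rightarrow> 'a \<Rightarrow> real"
      where f: "\<And>k. f k \<in> borel_measurable (sigma (space M) C)"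
        "\<And>k. AE \<omega> in M. \<omega> \<in> space M \<longrightarrow> \<bar>f k \<omega> - h \<omega>\<bar> \<le> 1 / Suc k"
      by auto
    show "\<exists>f\<in>borel_measurable (sigma (space M) C). AE \<omega> in M. h \<omega> = f \<omega>"
    proof
      \<comment> \<open>\<open>lim\<close> is total, so this function is measurable without any
        convergence; convergence to \<open>h\<close> is needed only almost everywhere.\<close>
      show "(\<lambda>\<omega>. lim (\<lambda>k. f k \<omega>)) \<in> borel_measurable (sigma (space M) C)"
        using f(1) by (rule borel_measurable_lim_metric)
      have "AE \<omega> in M. \<forall>k. \<omega> \<in> space M \<longrightarrow> \<bar>f k \<omega> - h \<omega>\<bar> \<le> 1 / Suc k"
        using f(2) by (simp add: AE_all_countable)
      then show "AE \<omega> in M. h \<omega> = lim (\<lambda>k. f k \<omega>)"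
        using AE_space
      proof eventually_elim
        case (elim \<omega>)
        have "(\<lambda>k. 1 / real (Suc k)) \<longlonglongrightarrow> 0"
          using LIMSEQ_inverse_real_of_nat by (simp add: inverse_eq_divide)
        then have "(\<lambda>k. f k \<omega> - h \<omega>) \<longlonglongrightarrow> 0"
          by (rule Lim_null_comparison[rotated]) (use elim in auto)
        then have "(\<lambda>k. f k \<omega>) \<longlonglongrightarrow> h \<omega>"
          by (simp add: LIM_zero_iff)
        then show ?case
          by (simp add: limI)
      qed
    qed
  qed
qed

subsection \<open>Borel sets of a Radon measure\<close>

lemma space_radon:
  assumes "\<mu> \<in> radon_probability_measures T"
  shows "space \<mu> = topspace T"
proof -
  have "space (borel_of T) = topspace T"
    by (simp add: borel_of_def space_measure_of_conv)
  moreover have "sets \<mu> = sets (borel_of T)"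
    using assms by (simp add: radon_probability_measures_def)
  ultimately show ?thesis
    using sets_eq_imp_space_eq by metis
qed

lemma sets_radon:
  assumes "\<mu> \<in> radon_probability_measures T"
  shows "sets \<mu> = sigma_sets (topspace T) {U. openin T U}"
proof -
  have "{U. openin T U} \<subseteq> Pow (topspace T)"
    using openin_subset by auto
  then show ?thesis
    using assms by (simp add: radon_probability_measures_def borel_of_def)
qed

lemma borel_measurable_radon:
  assumes "\<mu> \<in> radon_probability_measures T" "continuous_map T euclideanreal f"
  shows "f \<in> borel_measurable \<mu>"
proof (rule borel_measurableI)
  fix S :: "real set" assume "open S"
  then have "openin T {x \<in> topspace T. f x \<in> S}"
    using assms(2) by (intro openin_continuous_map_preimage) auto
  moreover have "f -` S \<inter> space \<mu> = {x \<in> topspace T. f x \<in> S}"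
    using space_radon[OF assms(1)] by auto
  ultimately show "f -` S \<inter> space \<mu> \<in> sets \<mu>"
    unfolding sets_radon[OF assms(1)] by (auto intro: sigma_sets.Basic)
qed

text \<open>The base may be uncountable, so an open \<open>U\<close> need not be a countable union
  of basic sets. But each compact subset of \<open>U\<close> lies in a finite union of basic sets
  inside \<open>U\<close>, and by inner regularity countably many such unions exhaust
  \<open>U\<close> up to a null set.\<close>

lemma radon_sets_subset_if_base:
  assumes \<mu>: "\<mu> \<in> radon_probability_measures T"
    and \<S>: "sigma_algebra (space \<mu>) \<S>" "\<S> \<subseteq> sets \<mu>"
    and null_closed: "\<And>A B. A \<in> sets \<mu> \<Longrightarrow> B \<in> \<S> \<Longrightarrow> AE x in \<mu>. x \<in> A \<longleftrightarrow> x \<in> B \<Longrightarrow> A \<in> \<S>"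
    and base: "\<And>U x. openin T U \<Longrightarrow> x \<in> U \<Longrightarrow> \<exists>V\<in>\<S>. openin T V \<and> x \<in> V \<and> V \<subseteq> U"
  shows "sets \<mu> \<subseteq> \<S>"
proof -
  interpret sigma_algebra "space \<mu>" \<S>
    by (rule \<S>(1))
  interpret prob_space \<mu>
    using \<mu> by (simp add: radon_probability_measures_def)
  have "U \<in> \<S>" if U: "openin T U" for U
  proof -
    have U_sets: "U \<in> sets \<mu>"
      unfolding sets_radon[OF \<mu>] using U by (auto intro: sigma_sets.Basic)
    let ?\<C> = "{C. compactin T C \<and> C \<subseteq> U}"
    have sep: "\<exists>V\<in>\<S>. C \<subseteq> V \<and> V \<subseteq> U" if "C \<in> ?\<C>" for C
    proof -
      let ?\<V> = "{V \<in> \<S>. openin T V \<and> V \<subseteq> U}"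
      have "C \<subseteq> \<Union>?\<V>"
        using that base[OF U] by blast
      moreover have "compactin T C" "\<And>V. V \<in> ?\<V> \<Longrightarrow> openin T V"
        using that by auto
      ultimately have "\<exists>\<F>. finite \<F> \<and> \<F> \<subseteq> ?\<V> \<and> C \<subseteq> \<Union>\<F>"
        by (intro compactinD)
      then obtain \<F> where \<F>: "finite \<F>" "\<F> \<subseteq> ?\<V>" "C \<subseteq> \<Union>\<F>"
        by blast
      then have "\<Union>\<F> \<in> \<S>"
        by (intro finite_Union) auto
      with \<F> show ?thesis
        by blast
    qed
    have "{} \<in> ?\<C>"
      by auto
    then have "?\<C> \<noteq> {}"
      by blast
    from ennreal_SUP_countable_SUP[OF this, of "emeasure \<mu>"] obtain f :: "nat \<Rightarrow> ennreal"
      where f: "range f \<subseteq> emeasure \<mu> ` ?\<C>" "(SUP C\<in>?\<C>. emeasure \<mu> C) = (SUP i. f i)"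
      by blast
    have "\<forall>i. \<exists>V. V \<in> \<S> \<and> V \<subseteq> U \<and> f i \<le> emeasure \<mu> V"
    proof
      fix i
      obtain C where C: "C \<in> ?\<C>" "f i = emeasure \<mu> C"
        using f(1) by blast
      with sep obtain V where "V \<in> \<S>" "C \<subseteq> V" "V \<subseteq> U"
        by blast
      \<comment> \<open>Monotonicity asks only for measurability of the larger set \<open>V\<close>,
        so nothing has to be known about that of \<open>C\<close>.\<close>
      with C(2) \<S>(2) show "\<exists>V. V \<in> \<S> \<and> V \<subseteq> U \<and> f i \<le> emeasure \<mu> V"
        by (intro exI[of _ V]) (auto intro!: emeasure_mono)
    qed
    from choice[OF this] obtain V where V: "\<And>i. V i \<in> \<S>" "\<And>i. V i \<subseteq> U" "\<And>i. f i \<le> emeasure \<mu> (V i)"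
      by blast
    let ?V = "\<Union>i. V i"
    have V_sets: "?V \<in> \<S>" "?V \<in> sets \<mu>"
      using V(1) \<S>(2) by auto
    have "emeasure \<mu> U = (SUP i. f i)"
      using \<mu> U_sets f(2) unfolding radon_probability_measures_def by auto
    also have "\<dots> \<le> emeasure \<mu> ?V"
    proof (rule SUP_least)
      fix i
      have "emeasure \<mu> (V i) \<le> emeasure \<mu> ?V"
        using V_sets by (intro emeasure_mono) auto
      with V(3)[of i] show "f i \<le> emeasure \<mu> ?V"
        by (rule order_trans)
    qed
    finally have "emeasure \<mu> U \<le> emeasure \<mu> ?V" .
    moreover have "emeasure \<mu> (U - ?V) = emeasure \<mu> U - emeasure \<mu> ?V"
      using V(2) V_sets U_sets by (intro emeasure_Diff) auto
    ultimately have "emeasure \<mu> (U - ?V) = 0"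
      using diff_eq_0_iff_ennreal[of "emeasure \<mu> U" "emeasure \<mu> ?V"]
      by (metis emeasure_finite less_top)
    then have "U - ?V \<in> null_sets \<mu>"
      using V_sets U_sets by auto
    then have "AE x in \<mu>. x \<notin> U - ?V"
      by (rule AE_not_in)
    then have "AE x in \<mu>. x \<in> U \<longleftrightarrow> x \<in> ?V"
      by eventually_elim (use V(2) in auto)
    with U_sets V_sets(1) show ?thesis
      by (rule null_closed)
  qed
  then have "sigma_sets (space \<mu>) {U. openin T U} \<subseteq> \<S>"
    by (intro sigma_sets_subset) auto
  then show ?thesis
    unfolding sets_radon[OF \<mu>] space_radon[OF \<mu>] .
qed

lemma mod_null_sigma_algebra:
  assumes "C \<subseteq> sets M"
  shows "sigma_algebra (space M)
    {A \<in> sets M. \<exists>B\<in>sigma_sets (space M) C. AE x in M. x \<in> A \<longleftrightarrow> x \<in> B}"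
    (is "sigma_algebra _ ?\<S>")
proof -
  have sC: "sigma_algebra (space M) (sigma_sets (space M) C)"
    using assms sets.space_closed[of M] by (intro sigma_algebra_sigma_sets) blast
  interpret C: sigma_algebra "space M" "sigma_sets (space M) C"
    by (rule sC)
  show ?thesis
    unfolding sigma_algebra_iff2
  proof (intro conjI ballI allI impI)
    show "?\<S> \<subseteq> Pow (space M)"
      using sets.space_closed[of M] by auto
    show "{} \<in> ?\<S>"
      by (auto intro!: bexI[of _ "{}"])
    fix A assume "A \<in> ?\<S>"
    then obtain B where A: "A \<in> sets M" and B: "B \<in> sigma_sets (space M) C"
        "AE x in M. x \<in> A \<longleftrightarrow> x \<in> B"
      by blast
    have "AE x in M. x \<in> space M - A \<longleftrightarrow> x \<in> space M - B"
      using B(2) by eventually_elim auto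
    with A B(1) show "space M - A \<in> ?\<S>"
      by blast
  next
    fix A :: "nat \<Rightarrow> 'a set" assume A: "range A \<subseteq> ?\<S>"
    then have "\<forall>i. \<exists>B. B \<in> sigma_sets (space M) C \<and> (AE x in M. x \<in> A i \<longleftrightarrow> x \<in> B)"
      by blast
    from choice[OF this] obtain B where B: "\<And>i. B i \<in> sigma_sets (space M) C"
        "\<And>i. AE x in M. x \<in> A i \<longleftrightarrow> x \<in> B i"
      by blast
    have "AE x in M. \<forall>i. x \<in> A i \<longleftrightarrow> x \<in> B i"
      using B(2) by (simp add: AE_all_countable)
    then have "AE x in M. x \<in> (\<Union>i. A i) \<longleftrightarrow> x \<in> (\<Union>i. B i)"
      by eventually_elim auto
    moreover have "(\<Union>i. B i) \<in> sigma_sets (space M) C"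
      using B(1) by auto
    moreover have "(\<Union>i. A i) \<in> sets M"
      using A by auto
    ultimately show "(\<Union>i. A i) \<in> ?\<S>"
      by blast
  qed
qed

subsection \<open>Topology of the domain\<close>

lemma separable_metrizable_countable_base:
  assumes "metrizable_space X" "separable_space X"
  obtains B :: "nat \<Rightarrow> 'a set" where "\<And>n. openin X (B n)"
    "\<And>U x. openin X U \<Longrightarrow> x \<in> U \<Longrightarrow> \<exists>n. x \<in> B n \<and> B n \<subseteq> U"
proof -
  from assms(1) obtain M d where "Metric_space M d" and X: "X = Metric_space.mtopology M d"
    by (auto simp: metrizable_space_def)
  then interpret Metric_space M d
    by simp
  from assms(2) obtain D where D: "countable D" "D \<subseteq> M" "mtopology closure_of D = M"
    unfolding separable_space_def X by auto
  \<comment> \<open>Inserting the empty set provides something to enumerate even when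
    \<open>D\<close> is empty.\<close>
  define \<B> where "\<B> = insert {} ((\<lambda>(c, k). mball c (1 / Suc k)) ` (D \<times> (UNIV :: nat set)))"
  have "countable \<B>" "\<B> \<noteq> {}"
    using D(1) by (auto simp: \<B>_def)
  then have range: "range (from_nat_into \<B>) = \<B>"
    by (intro range_from_nat_into)
  show ?thesis
  proof
    fix n
    have "from_nat_into \<B> n \<in> \<B>"
      using range by blast
    then show "openin X (from_nat_into \<B> n)"
      by (auto simp: \<B>_def X)
  next
    fix U x assume U: "openin X U" "x \<in> U"
    then have "x \<in> M"
      using openin_subset[OF U(1)] by (auto simp: X)
    obtain r where r: "r > 0" "mball x r \<subseteq> U"
      using U by (auto simp: X openin_mtopology)
    obtain k :: nat where k: "1 / Suc k < r / 2"
      using reals_Archimedean[of "r / 2"] r(1) by (auto simp: inverse_eq_divide)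
    have "x \<in> mtopology closure_of D"
      using D(3) \<open>x \<in> M\<close> by simp
    then obtain c where c: "c \<in> D" "c \<in> mball x (1 / Suc k)"
      unfolding metric_closure_of by (auto dest!: spec[of _ "1 / Suc k"])
    have "c \<in> M" "d x c < 1 / Suc k"
      using c by auto
    have "mball c (1 / Suc k) \<subseteq> mball x r"
    proof
      fix y assume y: "y \<in> mball c (1 / Suc k)"
      then have "d x y \<le> d x c + d c y"
        using \<open>x \<in> M\<close> \<open>c \<in> M\<close> by (intro triangle) auto
      with y \<open>d x c < 1 / Suc k\<close> k \<open>x \<in> M\<close> show "y \<in> mball x r"
        by auto
    qed
    moreover have "x \<in> mball c (1 / Suc k)"
      using c \<open>x \<in> M\<close> by (simp add: commute)
    moreover have "mball c (1 / Suc k) \<in> \<B>"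
      using c(1) by (auto simp: \<B>_def)
    then obtain n where "from_nat_into \<B> n = mball c (1 / Suc k)"
      using range by (metis imageE)
    ultimately show "\<exists>n. x \<in> from_nat_into \<B> n \<and> from_nat_into \<B> n \<subseteq> U"
      using r(2) by (intro exI[of _ n]) auto
  qed
qed

section \<open>Evaluations on \<open>K\<close> and the conclusion\<close>

theorem theorem4p4:
  fixes X :: "'a topology" and K :: "('a \<Rightarrow> real) set"
  assumes "metrizable_space X" and "separable_space X"
    and "compactin (powertop_real (topspace X)) K"
    and "\<And>g F. \<lbrakk>g \<in> K; closedin X F; F \<noteq> {}\<rbrakk> \<Longrightarrow>
           \<exists>x\<in>F. topcontinuous_at (subtopology X F) euclideanreal (restrict g F) x"
  shows "\<forall>\<mu> \<in> radon_probability_measures (subtopology (powertop_real (topspace X)) K).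
           countable_type \<mu>"
proof
  let ?P = "powertop_real (topspace X)"
  let ?T = "subtopology ?P K"
  fix \<mu> assume \<mu>: "\<mu> \<in> radon_probability_measures ?T"
  then interpret prob_space \<mu>
    by (simp add: radon_probability_measures_def)
  have K: "K \<subseteq> topspace ?P"
    using assms(3) by (rule compactin_subset_topspace)
  then have topT: "topspace ?T = K"
    by (auto simp: topspace_subtopology)
  with space_radon[OF \<mu>] have space: "space \<mu> = K"
    by simp
  obtain B :: "nat \<Rightarrow> 'a set" where B: "\<And>n. openin X (B n)"
      "\<And>U x. openin X U \<Longrightarrow> x \<in> U \<Longrightarrow> \<exists>n. x \<in> B n \<and> B n \<subseteq> U"
    using separable_metrizable_countable_base[OF assms(1,2)] by blast
  define e :: "'a \<Rightarrow> ('a \<Rightarrow> real) \<Rightarrow> real" where "e x g = g x" for x g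
  have e_cont: "continuous_map ?T euclideanreal (e x)" if "x \<in> topspace X" for x
    unfolding e_def[abs_def] using that
    by (intro continuous_map_from_subtopology continuous_map_product_projection)
  then have e_meas: "e x \<in> borel_measurable \<mu>" if "x \<in> topspace X" for x
    using that by (intro borel_measurable_radon[OF \<mu>])
  have approx: "sigma_approximable \<mu> \<delta> (e ` topspace X) (space \<mu>)" if "\<delta> > 0" for \<delta>
  proof (rule sigma_approximable_if_fragmented)
    show "B n \<subseteq> topspace X" for n
      using B(1) by (rule openin_subset)
    fix g J assume g: "g \<in> space \<mu>" and ne: "topspace X - (\<Union>n\<in>J. B n) \<noteq> {}"
    let ?F = "topspace X - (\<Union>n\<in>J. B n)"
    have "closedin X ?F"
      using B(1) by (intro closedin_diff) auto
    then obtain x where x: "x \<in> ?F"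
        "topcontinuous_at (subtopology X ?F) euclideanreal (restrict g ?F) x"
      using assms(4)[of g ?F] g ne space by blast
    \<comment> \<open>Radius \<open>\<delta> / 2\<close> around the value at the continuity point
      bounds the oscillation by \<delta>.\<close>
    let ?V = "{t. \<bar>t - g x\<bar> < \<delta> / 2}"
    have "open ?V"
      by (intro open_Collect_less continuous_intros)
    moreover have "restrict g ?F x \<in> ?V"
      using x(1) that by simp
    ultimately obtain U where U: "openin (subtopology X ?F) U" "x \<in> U"
        "\<forall>y\<in>U. restrict g ?F y \<in> ?V"
      using x(2) unfolding topcontinuous_at_def by (auto simp del: restrict_apply)
    then obtain U' where U': "openin X U'" "U = U' \<inter> ?F"
      by (auto simp: openin_subtopology)
    then obtain n where n: "x \<in> B n" "B n \<subseteq> U'"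
      using B(2) U(2) by blast
    have near: "\<bar>g y - g x\<bar> < \<delta> / 2" if "y \<in> B n - (\<Union>n\<in>J. B n)" for y
    proof -
      have "y \<in> ?F"
        using that openin_subset[OF B(1)[of n]] by blast
      moreover from this have "y \<in> U"
        using that n(2) U'(2) by blast
      ultimately show ?thesis
        using U(3) by fastforce
    qed
    have "\<bar>e y g - e z g\<bar> \<le> \<delta>"
      if "y \<in> B n - (\<Union>n\<in>J. B n)" "z \<in> B n - (\<Union>n\<in>J. B n)" for y z
      using near[OF that(1)] near[OF that(2)] unfolding e_def by linarith
    moreover have "B n - (\<Union>n\<in>J. B n) \<noteq> {}"
      using x(1) n(1) by blast
    ultimately show "\<exists>n. B n - (\<Union>n\<in>J. B n) \<noteq> {} \<and>
        (\<forall>x\<in>B n - (\<Union>n\<in>J. B n). \<forall>y\<in>B n - (\<Union>n\<in>J. B n). \<bar>e x g - e y g\<bar> \<le> \<delta>)"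
      by blast
  qed (rule e_meas)
  obtain C where C: "countable C" "C \<subseteq> sets \<mu>"
      "\<And>h. h \<in> e ` topspace X \<Longrightarrow> \<exists>f\<in>borel_measurable (sigma (space \<mu>) C). AE g in \<mu>. h g = f g"
  proof (rule countably_generated_if_sigma_approximable[of "e ` topspace X"])
    show "h \<in> borel_measurable \<mu>" if "h \<in> e ` topspace X" for h
      using that e_meas by blast
  qed (use approx in blast)+
  define \<S> where "\<S> = {A \<in> sets \<mu>. \<exists>B\<in>sigma_sets (space \<mu>) C. AE g in \<mu>. g \<in> A \<longleftrightarrow> g \<in> B}"
  have \<S>: "sigma_algebra (space \<mu>) \<S>"
    unfolding \<S>_def using C(2) by (rule mod_null_sigma_algebra)
  then interpret \<S>: sigma_algebra "space \<mu>" \<S> .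
  have C_Pow: "C \<subseteq> Pow (space \<mu>)"
    using C(2) sets.space_closed[of \<mu>] by blast
  \<comment> \<open>Each evaluation agrees almost everywhere with a function measurable for the
    \<sigma>-algebra generated by \<open>C\<close>, so one-coordinate cylinders with open base lie
    in \<open>\<S>\<close>.\<close>
  have eval: "{g \<in> space \<mu>. g x \<in> W} \<in> \<S>" if x: "x \<in> topspace X" and W: "open W" for x and W :: "real set"
  proof -
    obtain f where f: "f \<in> borel_measurable (sigma (space \<mu>) C)" "AE g in \<mu>. e x g = f g"
      using C(3) x by blast
    have "f -` W \<inter> space \<mu> \<in> sigma_sets (space \<mu>) C"
      using measurable_sets[OF f(1), of W] W C_Pow by (simp add: space_measure_of_conv)
    moreover have "AE g in \<mu>. g \<in> {g \<in> space \<mu>. g x \<in> W} \<longleftrightarrow> g \<in> f -` W \<inter> space \<mu>"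
      using f(2) by eventually_elim (auto simp: e_def)
    moreover have "{g \<in> space \<mu>. g x \<in> W} \<in> sets \<mu>"
    proof -
      have "e x -` W \<inter> space \<mu> \<in> sets \<mu>"
        using W by (intro measurable_sets[OF e_meas[OF x]]) auto
      moreover have "e x -` W \<inter> space \<mu> = {g \<in> space \<mu>. g x \<in> W}"
        by (auto simp: e_def)
      ultimately show ?thesis
        by simp
    qed
    ultimately show ?thesis
      unfolding \<S>_def by blast
  qed
  have "sets \<mu> \<subseteq> \<S>"
  proof (rule radon_sets_subset_if_base[OF \<mu> \<S>])
    show "\<S> \<subseteq> sets \<mu>"
      by (auto simp: \<S>_def)
    fix A A' assume A: "A \<in> sets \<mu>" "A' \<in> \<S>" "AE g in \<mu>. g \<in> A \<longleftrightarrow> g \<in> A'"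
    show "A \<in> \<S>"
    proof -
      obtain A'' where A'': "A'' \<in> sigma_sets (space \<mu>) C" "AE g in \<mu>. g \<in> A' \<longleftrightarrow> g \<in> A''"
        using A(2) by (auto simp: \<S>_def)
      have "AE g in \<mu>. g \<in> A \<longleftrightarrow> g \<in> A''"
        using A(3) A''(2) by eventually_elim auto
      with A(1) A''(1) show ?thesis
        unfolding \<S>_def by blast
    qed
  next
    show "\<exists>V\<in>\<S>. openin ?T V \<and> g \<in> V \<and> V \<subseteq> U" if U: "openin ?T U" "g \<in> U" for U g
    proof -
      obtain U' where U': "openin ?P U'" "U = U' \<inter> K"
        using U(1) by (auto simp: openin_subtopology)
      then obtain W where W: "finite {i \<in> topspace X. W i \<noteq> UNIV}"
          "\<And>i. i \<in> topspace X \<Longrightarrow> open (W i)"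
          "g \<in> Pi\<^sub>E (topspace X) W" "Pi\<^sub>E (topspace X) W \<subseteq> U'"
        using U(2) unfolding openin_product_topology_alt by fastforce
      \<comment> \<open>Only the finitely many coordinates with \<open>W i \<noteq> UNIV\<close>
        impose a condition, so this is a finite intersection of cylinders. It equals the trace of
        the product box because members of \<open>K\<close> are extensional.\<close>
      let ?V = "{h \<in> space \<mu>. \<forall>i\<in>{i \<in> topspace X. W i \<noteq> UNIV}. h i \<in> W i}"
      have V_eq: "?V = Pi\<^sub>E (topspace X) W \<inter> K"
        using K unfolding space by (auto simp: PiE_iff)
      have "openin ?P (Pi\<^sub>E (topspace X) W)"
        using W(1,2) by (subst openin_PiE_gen) auto
      then have "openin ?T ?V"
        unfolding V_eq by (auto simp: openin_subtopology)
      moreover have "?V \<in> \<S>"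
        using W(1,2) by (intro \<S>.sets_Collect_finite_All eval) auto
      moreover have "g \<in> ?V" "?V \<subseteq> U"
        using W(3,4) U'(2) U(2) unfolding V_eq by auto
      ultimately show ?thesis
        by blast
    qed
  qed
  then show "countable_type \<mu>"
    by (intro countable_type_if_countably_generated_mod_null[OF C(1,2)]) (auto simp: \<S>_def)
qed

end
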